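(* Let $m \ge 0$ be an integer, let $k \in \mathbb{N}$, $k\ge 1$, and let $z\in\mathbb{C}$. Then $$D_m^{(k)}(z) = m! \sum_{n=0}^m \binom{z}{m-n}\, b_n^{(-k)}.$$
   Context: All identities are of formal power series in $t$. The Daehee polynomials of order $k$ are defined by $$\sum_{n=0}^\infty D_n^{(k)}(x)\frac{t^n}{n!} = \left(\frac{\log(1+t)}{t}\right)^k (1+t)^x .$$ The Nörlund numbers of the second kind $b_n^{(x)}$ are defined, for any number $x$, by $$\left(\frac{t}{\log(1+t)}\right)^x = \sum_{n=0}^\infty b_n^{(x)} t^n$$ (the $x$-th power of a power series with constant term $1$); in particular $b_n^{(-k)}$ is the value at $x=-k$. Here $\binom{z}{j} = \frac{z(z-1)\cdots(z-j+1)}{j!}$ and $(1+t)^z=\sum_{j\ge0}\binom{z}{j}t^j$. *)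

theory Defs
  imports Complex_Main "HOL-Computational_Algebra.Formal_Power_Series"
begin

text \<open>
  Throughout, \<open>fps_ln 1\<close> is the series $\log(1+t)$, \<open>fps_binomial z\<close> is the series
  $(1+t)^z = \sum_j \binom{z}{j} t^j$, and \<open>fps_X\<close> is the indeterminate $t$.
\<close>

text \<open>
  The power $f^a = \sum_j \binom{a}{j} (f-1)^j$ with arbitrary exponent, i.e. the binomial series
  composed with $f - 1$. It is meaningful only if $f$ has constant term $1$.
\<close>
definition fps_gpow :: "complex fps \<Rightarrow> complex \<Rightarrow> complex fps" where
  "fps_gpow f a = fps_binomial a oo (f - 1)"

lemma fps_gpow_add:
  assumes "fps_nth f 0 = 1"
  shows "fps_gpow f (a + b) = fps_gpow f a * fps_gpow f b"
  using assms by (simp add: fps_gpow_def fps_binomial_add_mult fps_compose_mult_distrib)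

lemma fps_gpow_of_nat:
  assumes "fps_nth f 0 = 1"
  shows "fps_gpow f (of_nat n) = f ^ n"
proof -
  have "fps_gpow f (of_nat n) = ((1 + fps_X) oo (f - 1)) ^ n"
    using assms by (simp add: fps_gpow_def fps_binomial_of_nat fps_compose_power)
  then show ?thesis
    using assms by (simp add: fps_compose_add_distrib)
qed

text \<open>The quotients below are power series with constant term $1$, by exact division.\<close>

lemma fps_ln_div_X_nth_0: "fps_nth (fps_ln 1 / fps_X :: complex fps) 0 = 1"
  by (simp add: fps_ln_nth)

lemma fps_X_div_ln_nth_0: "fps_nth (fps_X / fps_ln 1 :: complex fps) 0 = 1"
proof -
  have *: "fps_ln 1 = fps_X * (fps_ln 1 / fps_X :: complex fps)"
    by (simp add: fps_eq_iff fps_ln_nth)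
  have nz: "fps_ln 1 / fps_X \<noteq> (0 :: complex fps)"
    using fps_ln_div_X_nth_0 by (metis fps_zero_nth zero_neq_one)
  have "fps_X / fps_ln 1 = (fps_X * 1) / (fps_X * (fps_ln 1 / fps_X :: complex fps))"
    using * by simp
  also have "\<dots> = 1 / (fps_ln 1 / fps_X)"
    by (rule div_mult_mult1) simp
  also have "\<dots> = inverse (fps_ln 1 / fps_X)"
    using fps_ln_div_X_nth_0 by (simp add: fps_divide_unit)
  finally show ?thesis
    using fps_ln_div_X_nth_0 by (simp add: fps_inverse_def)
qed

text \<open>
  Daehee polynomials of order \<open>k\<close>, as functions of \<open>x\<close>: \<open>daehee k n x\<close> is $n!$ times the
  coefficient of $t^n$ in $\left(\frac{\log(1+t)}{t}\right)^k (1+t)^x$.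
\<close>
definition daehee :: "nat \<Rightarrow> nat \<Rightarrow> complex \<Rightarrow> complex" where
  "daehee k n x = fact n * fps_nth ((fps_ln 1 / fps_X) ^ k * fps_binomial x) n"

text \<open>Noerlund numbers of the second kind: coefficients of $\left(\frac{t}{\log(1+t)}\right)^x$.\<close>
definition noerlund2 :: "nat \<Rightarrow> complex \<Rightarrow> complex" where
  "noerlund2 n x = fps_nth (fps_gpow (fps_X / fps_ln 1) x) n"

end

theory Submission
  imports Defs
begin

text \<open>The series log(1+t)/t and t/log(1+t) are mutually inverse. By the exponent law, the
  generalized power of t/log(1+t) at -k is therefore the ordinary k-th power of log(1+t)/t
  (\<open>fps_gpow_minus_of_nat\<close>). So b_n^(-k) are the coefficients of the first factor of
  the Daehee generating function, and the claim is its Cauchy product with (1+t)^z.\<close>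

lemma fps_ln_div_X_mult_X_div_ln:
  "(fps_ln 1 / fps_X) * (fps_X / fps_ln 1) = (1 :: complex fps)"
proof -
  let ?g = "fps_ln 1 / fps_X :: complex fps"
  \<comment> \<open>\<open>fps_ln 1\<close> has constant term 0, hence is no unit; cancelling
    \<open>fps_X\<close> leaves the unit \<open>?g\<close>.\<close>
  have ln_eq: "fps_ln 1 = fps_X * ?g"
    by (simp add: fps_eq_iff fps_ln_nth)
  have "fps_X / fps_ln 1 = (fps_X * 1) / (fps_X * ?g)"
    using ln_eq by simp
  also have "\<dots> = 1 / ?g"
    by (rule div_mult_mult1) simp
  also have "\<dots> = inverse ?g"
    using fps_ln_div_X_nth_0 by (simp add: fps_divide_unit)
  finally show ?thesis
    using fps_ln_div_X_nth_0 by (simp add: inverse_mult_eq_1')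
qed

text \<open>Since k + (-k) = 0, the exponent law makes the left side an inverse of
  \<open>f ^ k\<close>; \<open>g ^ k\<close> is another, and inverses are unique.\<close>

lemma fps_gpow_minus_of_nat:
  assumes "fps_nth f 0 = 1" and "g * f = 1"
  shows "fps_gpow f (- of_nat k) = g ^ k"
proof -
  have "f ^ k * fps_gpow f (- of_nat k) = fps_gpow f (of_nat 0)"
    using fps_gpow_add[OF assms(1), of "of_nat k" "- of_nat k"]
    by (simp add: fps_gpow_of_nat[OF assms(1)])
  \<comment> \<open>\<open>simp only\<close> keeps the form \<open>of_nat 0\<close>, which the rule
    for natural exponents matches.\<close>
  also have "\<dots> = 1"
    by (simp only: fps_gpow_of_nat[OF assms(1)] power_0)
  finally have "f ^ k * fps_gpow f (- of_nat k) = 1" .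
  moreover have "g ^ k * f ^ k = 1"
    by (simp add: assms(2) flip: power_mult_distrib)
  ultimately show ?thesis
    by (metis mult.assoc mult_1 mult_1_right)
qed

theorem theorem2p5:
  fixes m k :: nat and z :: complex
  assumes "k \<ge> 1"
  shows "daehee k m z
    = fact m * (\<Sum>n = 0..m. (z gchoose (m - n)) * noerlund2 n (- of_nat k))"
  unfolding daehee_def noerlund2_def
    fps_gpow_minus_of_nat[OF fps_X_div_ln_nth_0 fps_ln_div_X_mult_X_div_ln]
  \<comment> \<open>Both sides are now the same convolution, up to the order of the factors.\<close>
  by (simp only: fps_mult_nth fps_binomial_nth mult.commute[of "z gchoose _"])

end
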